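(* Let $X=(X,\tau)$ be a $d$-space. Suppose that the lattice $\Gamma(X)$ of closed subsets of $X$ is a complete Heyting algebra and that the specialization order $\Omega X$ is Artinian. Then $\Omega X$ is an algebraic dcpo and $\tau=\sigma(\Omega X)$. Consequently, $X$ is sober.
   Context: For a $T_0$ space $X=(X,\tau)$, $\Omega X$ is the set $X$ with the specialization order $x\le_\tau y$ iff $x\in\overline{\{y\}}$. $\Gamma(X)$ is the complete lattice of closed subsets ordered by inclusion. A complete Heyting algebra is a complete lattice with $a\wedge\bigvee S=\bigvee_{s\in S}(a\wedge s)$ for all $a$ and all subsets $S$. A dcpo is a poset in which every directed (nonempty) subset has a supremum. For a poset $P$, $\sigma(P)$ is the Scott topology: $U$ is open iff it is an upper set and every directed $D$ with existing supremum $\bigvee D\in U$ meets $U$. A $T_0$ space $X=(X,\tau)$ is a $d$-space (monotone convergence space) if $\Omega X$ is a dcpo and $\tau\subseteq\sigma(\Omega X)$. A poset is Artinian if every nonempty subset has a minimal element. An element $k$ of a dcpo $P$ is compact if for every directed $D$ with $k\le\bigvee D$ there is $d\in D$ with $k\le d$; $K(P)$ is the set of compact elements, and $P$ is algebraic if for every $x\in P$ the set $K(P)\cap{\downarrow}x$ is directed with supremum $x$. A $T_0$ space is sober if every (nonempty) irreducible closed subset is the closure of a unique point. *)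

theory Defs
  imports "HOL-Analysis.Analysis" "HOL-Algebra.Complete_Lattice"
begin

text \<open>
  Posets and lattices are the carrier-based structures of HOL-Algebra, spaces are values of type
  \<open>'a topology\<close>. Since HOL-Algebra also has a \<open>closure_of\<close>, the topological closure is written
  with its qualified name throughout.
\<close>

section \<open>Order theory\<close>

definition directed_in :: "('a, 'b) gorder_scheme \<Rightarrow> 'a set \<Rightarrow> bool" where
  "directed_in P D \<longleftrightarrow> D \<subseteq> carrier P \<and> D \<noteq> {} \<and>
     (\<forall>x\<in>D. \<forall>y\<in>D. \<exists>z\<in>D. x \<sqsubseteq>\<^bsub>P\<^esub> z \<and> y \<sqsubseteq>\<^bsub>P\<^esub> z)"

definition dcpo :: "('a, 'b) gorder_scheme \<Rightarrow> bool" where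
  "dcpo P \<longleftrightarrow> partial_order P \<and> (\<forall>D. directed_in P D \<longrightarrow> (\<exists>s. is_lub P s D))"

definition artinian_poset :: "('a, 'b) gorder_scheme \<Rightarrow> bool" where
  "artinian_poset P \<longleftrightarrow> partial_order P \<and>
     (\<forall>S \<subseteq> carrier P. S \<noteq> {} \<longrightarrow> (\<exists>m\<in>S. \<forall>y\<in>S. y \<sqsubseteq>\<^bsub>P\<^esub> m \<longrightarrow> y = m))"

definition compact_elements :: "('a, 'b) gorder_scheme \<Rightarrow> 'a set" where
  "compact_elements P = {k \<in> carrier P.
     \<forall>D s. directed_in P D \<longrightarrow> is_lub P s D \<longrightarrow> k \<sqsubseteq>\<^bsub>P\<^esub> s \<longrightarrow> (\<exists>d\<in>D. k \<sqsubseteq>\<^bsub>P\<^esub> d)}"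

definition algebraic_dcpo :: "('a, 'b) gorder_scheme \<Rightarrow> bool" where
  "algebraic_dcpo P \<longleftrightarrow> dcpo P \<and>
     (\<forall>x\<in>carrier P.
        directed_in P {k \<in> compact_elements P. k \<sqsubseteq>\<^bsub>P\<^esub> x} \<and>
        is_lub P x {k \<in> compact_elements P. k \<sqsubseteq>\<^bsub>P\<^esub> x})"

definition complete_heyting_algebra :: "('a, 'b) gorder_scheme \<Rightarrow> bool" where
  "complete_heyting_algebra L \<longleftrightarrow> complete_lattice L \<and>
     (\<forall>a\<in>carrier L. \<forall>S \<subseteq> carrier L.
        a \<sqinter>\<^bsub>L\<^esub> (\<Squnion>\<^bsub>L\<^esub> S) = \<Squnion>\<^bsub>L\<^esub> ((\<lambda>s. a \<sqinter>\<^bsub>L\<^esub> s) ` S))"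

section \<open>Scott topology\<close>

definition scott_open :: "('a, 'b) gorder_scheme \<Rightarrow> 'a set \<Rightarrow> bool" where
  "scott_open P U \<longleftrightarrow> U \<subseteq> carrier P \<and>
     (\<forall>x\<in>U. \<forall>y\<in>carrier P. x \<sqsubseteq>\<^bsub>P\<^esub> y \<longrightarrow> y \<in> U) \<and>
     (\<forall>D s. directed_in P D \<longrightarrow> is_lub P s D \<longrightarrow> s \<in> U \<longrightarrow> D \<inter> U \<noteq> {})"

definition scott_topology :: "('a, 'b) gorder_scheme \<Rightarrow> 'a topology" where
  "scott_topology P = topology (scott_open P)"

lemma istopology_scott_open: "istopology (scott_open P)"
proof -
  have "scott_open P (S \<inter> T)" if S: "scott_open P S" and T: "scott_open P T" for S T
  proof -
    have "D \<inter> (S \<inter> T) \<noteq> {}" if D: "directed_in P D" and s: "is_lub P s D" "s \<in> S \<inter> T" for D s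
    proof -
      obtain d where d: "d \<in> D" "d \<in> S"
        using S D s unfolding scott_open_def by blast
      obtain e where e: "e \<in> D" "e \<in> T"
        using T D s unfolding scott_open_def by blast
      obtain z where z: "z \<in> D" "d \<sqsubseteq>\<^bsub>P\<^esub> z" "e \<sqsubseteq>\<^bsub>P\<^esub> z"
        using D d e unfolding directed_in_def by blast
      moreover have "z \<in> carrier P"
        using D z unfolding directed_in_def by blast
      ultimately show ?thesis
        using S T d e unfolding scott_open_def by blast
    qed
    with S T show ?thesis unfolding scott_open_def by blast
  qed
  moreover have "scott_open P (\<Union>K)" if "\<forall>S\<in>K. scott_open P S" for K
    unfolding scott_open_def
  proof (intro conjI allI impI)
    show "\<Union>K \<subseteq> carrier P"
      using that unfolding scott_open_def by blast
    show "\<forall>x\<in>\<Union>K. \<forall>y\<in>carrier P. x \<sqsubseteq>\<^bsub>P\<^esub> y \<longrightarrow> y \<in> \<Union>K"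
      using that unfolding scott_open_def by blast
    fix D s assume D: "directed_in P D" "is_lub P s D" "s \<in> \<Union>K"
    then obtain S where S: "S \<in> K" "s \<in> S" by blast
    with that D have "D \<inter> S \<noteq> {}" unfolding scott_open_def by blast
    with S show "D \<inter> \<Union>K \<noteq> {}" by blast
  qed
  ultimately show ?thesis unfolding istopology_def by blast
qed

lemma openin_scott_topology: "openin (scott_topology P) = scott_open P"
  by (simp add: scott_topology_def istopology_scott_open topology_inverse')

section \<open>Spaces\<close>

definition specialization_order :: "'a topology \<Rightarrow> 'a gorder" where
  "specialization_order X = \<lparr>carrier = topspace X, eq = (=),
     le = (\<lambda>x y. x \<in> Abstract_Topology.closure_of X {y})\<rparr>"

definition closed_lattice :: "'a topology \<Rightarrow> 'a set gorder" where
  "closed_lattice X = \<lparr>carrier = {C. closedin X C}, eq = (=), le = (\<subseteq>)\<rparr>"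

definition d_space :: "'a topology \<Rightarrow> bool" where
  "d_space X \<longleftrightarrow> t0_space X \<and> dcpo (specialization_order X) \<and>
     (\<forall>U. openin X U \<longrightarrow> openin (scott_topology (specialization_order X)) U)"

definition irreducible_closedin :: "'a topology \<Rightarrow> 'a set \<Rightarrow> bool" where
  "irreducible_closedin X C \<longleftrightarrow> closedin X C \<and> C \<noteq> {} \<and>
     (\<forall>A B. closedin X A \<longrightarrow> closedin X B \<longrightarrow> C \<subseteq> A \<union> B \<longrightarrow> C \<subseteq> A \<or> C \<subseteq> B)"

definition sober_space :: "'a topology \<Rightarrow> bool" where
  "sober_space X \<longleftrightarrow> t0_space X \<and>
     (\<forall>C. irreducible_closedin X C \<longrightarrow>
        (\<exists>!x. x \<in> topspace X \<and> C = Abstract_Topology.closure_of X {x}))"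

end

theory Submission
  imports Defs
begin

text \<open>
  Distributivity in \<open>\<Gamma>(X)\<close> says that \<open>x\<close> lies in the closure of a lower set \<open>A\<close> only if it lies
  in the closure of \<open>\<downarrow>x \<inter> A\<close>. Hence if \<open>\<downarrow>x - {x}\<close> is closed, then \<open>x\<close> is not in the closure of
  \<open>X - \<uparrow>x\<close>, so \<open>\<uparrow>x\<close> is open. If \<open>\<downarrow>x - {x}\<close> is not closed, then \<open>x\<close> lies in its closure, so
  by well-founded induction every \<open>x\<close> is in the closure of those \<open>k \<le> x\<close> for which \<open>\<uparrow>k\<close> is open.
  These \<open>k\<close> are exactly the compact elements, which gives algebraicity, \<open>\<tau> = \<sigma>(\<Omega>X)\<close> and sobriety.
\<close>

abbreviation cl :: "'a topology \<Rightarrow> 'a set \<Rightarrow> 'a set" where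
  "cl \<equiv> Abstract_Topology.closure_of"

section \<open>The lattice of closed sets\<close>

lemma closed_lattice_sup:
  assumes S: "S \<subseteq> carrier (closed_lattice X)"
  shows "\<Squnion>\<^bsub>closed_lattice X\<^esub> S = cl X (\<Union>S)"
proof -
  have closed: "closedin X C" if "C \<in> S" for C
    using S that by (auto simp: closed_lattice_def)
  have sub: "\<Union>S \<subseteq> topspace X"
    using closed closedin_subset by fastforce
  have lub: "is_lub (closed_lattice X) (cl X (\<Union>S)) S"
    unfolding least_def Upper_def closed_lattice_def
  proof (simp, intro conjI ballI allI impI subsetI)
    show "x \<in> cl X (\<Union>S)" if "C \<in> S \<and> closedin X C" "x \<in> C" for C x
      using that closure_of_subset[OF sub] by blast
    show "x \<in> T" if "T \<in> {u. \<forall>C. C \<in> S \<and> closedin X C \<longrightarrow> C \<subseteq> u} \<inter> Collect (closedin X)"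
      and "x \<in> cl X (\<Union>S)" for T x
      using that closed closure_of_minimal[of "\<Union>S" T X] by blast
  qed
  \<comment> \<open>\<open>sup_def\<close> selects a least upper bound by \<open>SOME\<close>, so
    its uniqueness is needed as well.\<close>
  moreover have "T = cl X (\<Union>S)" if "is_lub (closed_lattice X) T S" for T
    using that lub unfolding least_def closed_lattice_def by auto
  ultimately show ?thesis
    unfolding sup_def by (rule some_equality)
qed

lemma closed_lattice_meet:
  assumes "closedin X A" "closedin X B"
  shows "A \<sqinter>\<^bsub>closed_lattice X\<^esub> B = A \<inter> B"
proof -
  have glb: "is_glb (closed_lattice X) (A \<inter> B) {A, B}"
    using assms by (auto simp: greatest_def Lower_def closed_lattice_def)
  moreover have "T = A \<inter> B" if "is_glb (closed_lattice X) T {A, B}" for T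
    using that glb unfolding greatest_def closed_lattice_def by auto
  ultimately show ?thesis
    unfolding meet_def inf_def by (rule some_equality)
qed

text \<open>Joins are closures of unions and meets are intersections, so the Heyting law becomes a
  statement about sets. Applied to a family of point closures, it lets the union of \<open>S\<close>
  be an arbitrary lower set.\<close>

lemma closed_lattice_distrib:
  assumes cha: "complete_heyting_algebra (closed_lattice X)"
    and A: "closedin X A" and S: "\<And>C. C \<in> S \<Longrightarrow> closedin X C"
  shows "A \<inter> cl X (\<Union>S) = cl X (A \<inter> \<Union>S)"
proof -
  let ?L = "closed_lattice X"
  have SL: "S \<subseteq> carrier ?L" and "A \<in> carrier ?L"
    using A S by (auto simp: closed_lattice_def)
  then have "A \<sqinter>\<^bsub>?L\<^esub> (\<Squnion>\<^bsub>?L\<^esub> S) = \<Squnion>\<^bsub>?L\<^esub> ((\<lambda>s. A \<sqinter>\<^bsub>?L\<^esub> s) ` S)"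
    using cha unfolding complete_heyting_algebra_def by blast
  moreover have "(\<lambda>s. A \<sqinter>\<^bsub>?L\<^esub> s) ` S = (\<lambda>s. A \<inter> s) ` S"
    using closed_lattice_meet[OF A S] by (intro image_cong refl)
  moreover have "(\<lambda>s. A \<inter> s) ` S \<subseteq> carrier ?L"
    using A S by (auto simp: closed_lattice_def)
  moreover have "\<Union>((\<lambda>s. A \<inter> s) ` S) = A \<inter> \<Union>S"
    by blast
  ultimately show ?thesis
    using A SL by (simp add: closed_lattice_sup closed_lattice_meet)
qed

section \<open>The specialization order\<close>

lemma carrier_specialization_order [simp]: "carrier (specialization_order X) = topspace X"
  by (simp add: specialization_order_def)

lemma le_specialization_order [simp]:
  "x \<sqsubseteq>\<^bsub>specialization_order X\<^esub> y \<longleftrightarrow> x \<in> cl X {y}"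
  by (simp add: specialization_order_def)

lemma specialization_refl:
  "x \<in> topspace X \<Longrightarrow> x \<in> cl X {x}"
  using closure_of_subset[of "{x}" X] by simp

lemma closure_of_singleton_subset:
  "closedin X C \<Longrightarrow> x \<in> C \<Longrightarrow> cl X {x} \<subseteq> C"
  by (rule closure_of_minimal) simp_all

lemma specialization_trans:
  "x \<in> cl X {y} \<Longrightarrow> y \<in> cl X {z} \<Longrightarrow> x \<in> cl X {z}"
  by (rule subsetD[OF closure_of_singleton_subset[OF closedin_closure_of]])

lemma specialization_openin:
  "openin X U \<Longrightarrow> x \<in> U \<Longrightarrow> x \<in> cl X {y} \<Longrightarrow> y \<in> U"
  unfolding in_closure_of by blast

lemma specialization_in_topspace:
  assumes "x \<in> cl X {y}"
  shows "x \<in> topspace X \<and> y \<in> topspace X"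
proof
  show "x \<in> topspace X"
    using assms by (rule subsetD[OF closure_of_subset_topspace])
  then show "y \<in> topspace X"
    using assms by (rule specialization_openin[OF openin_topspace])
qed

text \<open>\<open>Upper\<close> tests only those members of \<open>D\<close> that lie in the
  carrier, hence the intersections with \<open>topspace X\<close>.\<close>

lemma is_lub_specialization_order:
  "is_lub (specialization_order X) s D \<longleftrightarrow> s \<in> topspace X \<and>
     (\<forall>d\<in>D \<inter> topspace X. d \<in> cl X {s}) \<and>
     (\<forall>u\<in>topspace X. (\<forall>d\<in>D \<inter> topspace X. d \<in> cl X {u}) \<longrightarrow>
        s \<in> cl X {u})"
proof -
  let ?P = "specialization_order X"
  have "u \<in> Upper ?P D \<longleftrightarrow>
      u \<in> topspace X \<and> (\<forall>d\<in>D \<inter> topspace X. d \<in> cl X {u})" for u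
    unfolding Upper_def by auto
  moreover have "Upper ?P D \<subseteq> carrier ?P"
    by (rule Upper_closed)
  ultimately show ?thesis
    unfolding least_def le_specialization_order Ball_def by (simp add: imp_conjL)
qed

section \<open>Points with open principal upper sets\<close>

definition open_points :: "'a topology \<Rightarrow> 'a set" where
  "open_points X =
     {k \<in> topspace X. openin X {y \<in> topspace X. k \<in> cl X {y}}}"

abbreviation open_points_below :: "'a topology \<Rightarrow> 'a \<Rightarrow> 'a set" where
  "open_points_below X x \<equiv> {k \<in> open_points X. k \<in> cl X {x}}"

lemma open_points_if_closedin_strict_downset:
  assumes cha: "complete_heyting_algebra (closed_lattice X)" and x: "x \<in> topspace X"
    and closed: "closedin X (cl X {x} - {x})"
  shows "x \<in> open_points X"
proof -
  let ?U = "{y \<in> topspace X. x \<in> cl X {y}}"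
  \<comment> \<open>The complement of \<open>?U\<close> is a lower set, hence the union of the
    closures of its points. This makes it a union of closed sets, to which distributivity
    applies.\<close>
  define S where "S = (\<lambda>y. cl X {y}) ` (topspace X - ?U)"
  have S: "\<Union>S = topspace X - ?U"
  proof
    show "\<Union>S \<subseteq> topspace X - ?U"
      unfolding S_def
      using specialization_trans[of x X] specialization_in_topspace[of _ X] by blast
    show "topspace X - ?U \<subseteq> \<Union>S"
      unfolding S_def using specialization_refl[of _ X] by blast
  qed
  have "cl X {x} \<inter> cl X (\<Union>S) = cl X (cl X {x} \<inter> \<Union>S)"
    using cha by (rule closed_lattice_distrib) (auto simp: S_def)
  \<comment> \<open>A point outside \<open>?U\<close> is not above \<open>x\<close>, so by
    reflexivity it differs from \<open>x\<close>.\<close>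
  also have "cl X {x} \<inter> \<Union>S \<subseteq> cl X {x} - {x}"
    using x specialization_refl[OF x] unfolding S by blast
  then have "cl X (cl X {x} \<inter> \<Union>S) \<subseteq> cl X {x} - {x}"
    using closed by (rule closure_of_minimal)
  finally have "x \<notin> cl X (\<Union>S)"
    using specialization_refl[OF x] by blast
  \<comment> \<open>Closed sets are lower sets, so a point of \<open>?U\<close> in the closure would
    bring \<open>x\<close> with it. Hence the closure adds nothing to the complement of
    \<open>?U\<close>.\<close>
  moreover have "x \<in> cl X (\<Union>S)" if "y \<in> ?U" "y \<in> cl X (\<Union>S)" for y
    using that closure_of_singleton_subset[OF closedin_closure_of that(2)] by blast
  ultimately have "cl X (\<Union>S) \<subseteq> \<Union>S"
    using closure_of_subset_topspace[of X "\<Union>S"] unfolding S by blast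
  then have "closedin X (topspace X - ?U)"
    using closure_of_subset_eq[of "\<Union>S" X] unfolding S by blast
  then show ?thesis
    using x unfolding open_points_def by (simp add: openin_closedin subset_iff)
qed

lemma closure_of_open_points_below:
  assumes cha: "complete_heyting_algebra (closed_lattice X)"
    and art: "artinian_poset (specialization_order X)" and x: "x \<in> topspace X"
  shows "x \<in> cl X (open_points_below X x)"
proof (rule ccontr)
  \<comment> \<open>The counterexamples; the Artinian property yields a minimal one,
    \<open>m\<close>, and every point strictly below \<open>m\<close> then satisfies the
    claim.\<close>
  let ?B = "{x \<in> topspace X. x \<notin> cl X (open_points_below X x)}"
  assume "x \<notin> cl X (open_points_below X x)"
  with x have "?B \<noteq> {}" by blast
  moreover have "?B \<subseteq> carrier (specialization_order X)" by simp
  moreover have "\<forall>S\<subseteq>carrier (specialization_order X). S \<noteq> {} \<longrightarrow>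
      (\<exists>m\<in>S. \<forall>y\<in>S. y \<sqsubseteq>\<^bsub>specialization_order X\<^esub> m \<longrightarrow> y = m)"
    using art by (simp add: artinian_poset_def)
  ultimately have "\<exists>m\<in>?B. \<forall>y\<in>?B. y \<sqsubseteq>\<^bsub>specialization_order X\<^esub> m \<longrightarrow> y = m"
    by meson
  then obtain m where m: "m \<in> ?B" and min: "\<And>y. y \<in> ?B \<Longrightarrow> y \<in> cl X {m} \<Longrightarrow> y = m"
    unfolding le_specialization_order by blast
  have mm: "m \<in> cl X {m}"
    using m specialization_refl[of m X] by blast
  have sub: "open_points_below X m \<subseteq> topspace X"
    by (auto simp: open_points_def)
  have "y \<in> cl X (open_points_below X m)" if y: "y \<in> cl X {m} - {m}" for y
  proof -
    have "y \<in> cl X (open_points_below X y)"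
      using y min[of y] specialization_in_topspace[of y X m] by blast
    moreover have "open_points_below X y \<subseteq> open_points_below X m"
      using y specialization_trans[of _ X y m] by blast
    ultimately show ?thesis
      using closure_of_mono[of "open_points_below X y" "open_points_below X m" X] by blast
  qed
  then have "cl X (cl X {m} - {m}) \<subseteq> cl X (open_points_below X m)"
    by (intro closure_of_minimal) auto
  then have "m \<notin> cl X (cl X {m} - {m})"
    using m by blast
  moreover have "cl X (cl X {m} - {m}) \<subseteq> cl X {m}"
    by (intro closure_of_minimal) auto
  \<comment> \<open>The closure of the strict lower set of \<open>m\<close> stays below
    \<open>m\<close> and misses \<open>m\<close>, so it adds no point. The previous lemma then puts
    \<open>m\<close> among its own open points, contradicting its choice.\<close>
  ultimately have "closedin X (cl X {m} - {m})"
    using closure_of_subset_eq[of "cl X {m} - {m}" X] closure_of_subset_topspace[of X "{m}"] by blast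
  then have "m \<in> open_points_below X m"
    using open_points_if_closedin_strict_downset[OF cha] m mm by blast
  then show False
    using closure_of_subset[OF sub] m by blast
qed

section \<open>Algebraicity, the Scott topology and sobriety\<close>

theorem theorem6p3:
  fixes X :: "'a topology"
  assumes "d_space X"
    and "complete_heyting_algebra (closed_lattice X)"
    and "artinian_poset (specialization_order X)"
  shows "algebraic_dcpo (specialization_order X) \<and>
         X = scott_topology (specialization_order X) \<and>
         sober_space X"
proof -
  let ?P = "specialization_order X"
  let ?K = "open_points X"
  let ?up = "\<lambda>k. {y \<in> topspace X. k \<in> cl X {y}}"
  have t0: "t0_space X" and dcpo: "dcpo ?P"
    using assms(1) by (auto simp: d_space_def)
  have scott: "scott_open ?P U" if "openin X U" for U
    using assms(1) that by (simp add: d_space_def openin_scott_topology)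
  have po: "partial_order ?P"
    using dcpo by (simp add: dcpo_def)
  have antisym: "x = y" if "x \<in> cl X {y}" "y \<in> cl X {x}" for x y
    using partial_order.le_antisym[OF po, of x y] that specialization_in_topspace[of x X y] by simp
  have K: "k \<in> topspace X" "openin X (?up k)" "k \<in> ?up k" if "k \<in> ?K" for k
    using that specialization_refl[of k X] by (simp_all add: open_points_def)
  \<comment> \<open>The closure statement read through neighbourhoods; this form supplies the upper
    bounds in both directedness proofs.\<close>
  have dense: "\<exists>k\<in>?K. k \<in> cl X {x} \<and> k \<in> U" if "openin X U" "x \<in> U" for x U
  proof -
    have "x \<in> topspace X"
      using that openin_subset by blast
    then have "x \<in> cl X (open_points_below X x)"
      by (rule closure_of_open_points_below[OF assms(2,3)])
    then show ?thesis
      using that unfolding in_closure_of by blast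
  qed
  have directed: "directed_in ?P (open_points_below X x)" if x: "x \<in> topspace X" for x
    unfolding directed_in_def
  proof (intro conjI ballI)
    show "open_points_below X x \<subseteq> carrier ?P"
      using K by auto
    show "open_points_below X x \<noteq> {}"
      using dense[OF openin_topspace x] by blast
    fix k l assume kl: "k \<in> open_points_below X x" "l \<in> open_points_below X x"
    \<comment> \<open>An open point below \<open>x\<close> in this neighbourhood of \<open>x\<close>
      is a common upper bound of \<open>k\<close> and \<open>l\<close>.\<close>
    then have "openin X (?up k \<inter> ?up l)" "x \<in> ?up k \<inter> ?up l"
      using K(2) x by (auto simp: openin_Int)
    then show "\<exists>z\<in>open_points_below X x. k \<sqsubseteq>\<^bsub>?P\<^esub> z \<and> l \<sqsubseteq>\<^bsub>?P\<^esub> z"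
      using dense[of "?up k \<inter> ?up l" x] by auto
  qed
  have lub: "is_lub ?P x (open_points_below X x)" if x: "x \<in> topspace X" for x
    unfolding is_lub_specialization_order
  proof (intro conjI ballI impI)
    show "x \<in> topspace X" by (rule x)
    show "d \<in> cl X {x}" if "d \<in> open_points_below X x \<inter> topspace X" for d
      using that by blast
    fix u assume "u \<in> topspace X" and
      u: "\<forall>d\<in>open_points_below X x \<inter> topspace X. d \<in> cl X {u}"
    \<comment> \<open>The lower set of the upper bound \<open>u\<close> is closed, so it absorbs the
      closure of the open points below \<open>x\<close>, which contains \<open>x\<close>.\<close>
    have "open_points_below X x \<subseteq> cl X {u}"
      using u K by blast
    then have "cl X (open_points_below X x) \<subseteq> cl X {u}"
      by (intro closure_of_minimal) auto
    then show "x \<in> cl X {u}"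
      using closure_of_open_points_below[OF assms(2,3) x] by blast
  qed
  have compact: "compact_elements ?P = ?K"
  proof
    show "compact_elements ?P \<subseteq> ?K"
    proof
      fix c assume c: "c \<in> compact_elements ?P"
      then have cX: "c \<in> topspace X"
        by (auto simp: compact_elements_def)
      \<comment> \<open>Compactness is applied to \<open>c\<close> as the directed supremum of the
        open points below it: \<open>c\<close> lies below one of them, hence equals it.\<close>
      have "\<exists>d\<in>open_points_below X c. c \<sqsubseteq>\<^bsub>?P\<^esub> d"
        using c directed[OF cX] lub[OF cX] specialization_refl[OF cX]
        unfolding compact_elements_def le_specialization_order by blast
      then obtain d where "d \<in> ?K" "d \<in> cl X {c}" "c \<in> cl X {d}"
        by auto
      then show "c \<in> ?K"
        using antisym[of c d] by simp
    qed
    show "?K \<subseteq> compact_elements ?P"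
    proof
      fix k assume k: "k \<in> ?K"
      have "\<exists>d\<in>D. k \<sqsubseteq>\<^bsub>?P\<^esub> d"
        if "directed_in ?P D" "is_lub ?P s D" "k \<sqsubseteq>\<^bsub>?P\<^esub> s" for D s
      proof -
        \<comment> \<open>Since \<open>X\<close> is a d-space, the open set \<open>?up k\<close> is
          Scott open, so a directed set whose supremum lies in it must meet it.\<close>
        have "s \<in> ?up k"
          using that(3) specialization_in_topspace[of k X s] by simp
        then have "D \<inter> ?up k \<noteq> {}"
          using that scott[OF K(2)[OF k]] unfolding scott_open_def by blast
        then show ?thesis by auto
      qed
      then show "k \<in> compact_elements ?P"
        using K(1)[OF k] unfolding compact_elements_def by simp
    qed
  qed
  have "algebraic_dcpo ?P"
    unfolding algebraic_dcpo_def compact using dcpo directed lub by simp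
  moreover have "X = scott_topology ?P"
    unfolding topology_eq openin_scott_topology
  proof (intro allI iffI)
    \<comment> \<open>As \<open>x\<close> is the directed supremum of the open points below it,
      \<open>U\<close> contains one of these, \<open>k\<close>; then \<open>?up k\<close> is an open
      neighbourhood of \<open>x\<close> inside \<open>U\<close>. The converse inclusion is part of
      being a d-space.\<close>
    fix U assume U: "scott_open ?P U"
    show "openin X U"
    proof (subst openin_subopen, intro ballI)
      fix x assume x: "x \<in> U"
      then have xX: "x \<in> topspace X"
        using U unfolding scott_open_def by auto
      then have "open_points_below X x \<inter> U \<noteq> {}"
        using U x directed[OF xX] lub[OF xX] unfolding scott_open_def by blast
      then obtain k where k: "k \<in> ?K" "k \<in> cl X {x}" "k \<in> U" by blast
      have "?up k \<subseteq> U"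
        using U k(3) by (auto simp: scott_open_def)
      then show "\<exists>T. openin X T \<and> x \<in> T \<and> T \<subseteq> U"
        using k K(2)[OF k(1)] xX by (intro exI[of _ "?up k"]) simp
    qed
  qed (rule scott)
  moreover have "\<exists>!x. x \<in> topspace X \<and> C = cl X {x}" if C: "irreducible_closedin X C" for C
  proof -
    have closed: "closedin X C" and "C \<noteq> {}"
      and irred: "\<And>A B. closedin X A \<Longrightarrow> closedin X B \<Longrightarrow> C \<subseteq> A \<union> B \<Longrightarrow> C \<subseteq> A \<or> C \<subseteq> B"
      using C unfolding irreducible_closedin_def by blast+
    have CX: "C \<subseteq> topspace X"
      using closedin_subset[OF closed] by blast
    have down: "y \<in> C" if "x \<in> C" "y \<in> cl X {x}" for x y
      using that closure_of_singleton_subset[OF closed] by blast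
    \<comment> \<open>The generic point of \<open>C\<close> will be the supremum of the open points
      in \<open>C\<close>.\<close>
    have dir: "directed_in ?P (?K \<inter> C)"
      unfolding directed_in_def
    proof (intro conjI ballI)
      show "?K \<inter> C \<subseteq> carrier ?P"
        using K by auto
      show "?K \<inter> C \<noteq> {}"
        using dense[OF openin_topspace] \<open>C \<noteq> {}\<close> CX down by blast
      fix k l assume kl: "k \<in> ?K \<inter> C" "l \<in> ?K \<inter> C"
      have closed_up: "closedin X (topspace X - ?up k)" "closedin X (topspace X - ?up l)"
        using K(2) kl by (simp_all add: closedin_diff)
      have "k \<in> ?up k" "l \<in> ?up l"
        using K(3) kl by blast+
      \<comment> \<open>\<open>C\<close> meets both open sets \<open>?up k\<close> and
        \<open>?up l\<close>, so irreducibility, applied to their complements, gives a point of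
        \<open>C\<close> in both.\<close>
      then have "\<not> (C \<subseteq> topspace X - ?up k \<or> C \<subseteq> topspace X - ?up l)"
        using kl by blast
      then have "\<not> C \<subseteq> (topspace X - ?up k) \<union> (topspace X - ?up l)"
        by (rule contrapos_nn) (rule irred[OF closed_up])
      then obtain y where y: "y \<in> C" "y \<in> ?up k \<inter> ?up l"
        using CX by blast
      moreover have "openin X (?up k \<inter> ?up l)"
        using K(2) kl by (simp add: openin_Int)
      ultimately obtain z where "z \<in> ?K" "z \<in> cl X {y}" "z \<in> ?up k \<inter> ?up l"
        using dense[of "?up k \<inter> ?up l" y] by blast
      then show "\<exists>z\<in>?K \<inter> C. k \<sqsubseteq>\<^bsub>?P\<^esub> z \<and> l \<sqsubseteq>\<^bsub>?P\<^esub> z"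
        using y(1) down[of y z] by auto
    qed
    then obtain s where s: "is_lub ?P s (?K \<inter> C)"
      using dcpo unfolding dcpo_def by blast
    have sX: "s \<in> topspace X"
      using s unfolding is_lub_specialization_order by blast
    \<comment> \<open>The complement of \<open>C\<close> is Scott open; if it contained
      \<open>s\<close>, it would meet the directed set \<open>?K \<inter> C\<close>.\<close>
    have sC: "s \<in> C"
      using scott[OF openin_diff[OF openin_topspace closed]] dir s sX unfolding scott_open_def by blast
    \<comment> \<open>Each \<open>x\<close> in \<open>C\<close> is the supremum of the open points
      below it. These lie in the lower set \<open>C\<close>, hence below \<open>s\<close>.\<close>
    have Cs: "C \<subseteq> cl X {s}"
    proof
      fix x assume x: "x \<in> C"
      have "open_points_below X x \<subseteq> cl X {s}"
        using s down[OF x] K(1) unfolding is_lub_specialization_order by blast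
      then show "x \<in> cl X {s}"
        using lub[of x] x CX sX unfolding is_lub_specialization_order by blast
    qed
    have "C = cl X {s}"
      using Cs closure_of_singleton_subset[OF closed sC] by blast
    moreover have "x = s" if "x \<in> topspace X" "C = cl X {x}" for x
      using that sC Cs specialization_refl[of x X] antisym[of x s] by blast
    ultimately show ?thesis
      using sX by blast
  qed
  ultimately show ?thesis
    using t0 unfolding sober_space_def by blast
qed

end
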